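(* Let $K_1,\ldots,K_m$ and $R$ be consistent propositional formulae. If the maxsets of $K_1,\ldots,K_m$ form a Berge-acyclic hypergraph, then the labeling algorithm described in the context (whichever arbitrary choices are made in its steps) establishes whether $R$ is obtainable by priority base merging from $K_1,\ldots,K_m$, and outputs a priority ordering that generates $R$ if one exists.
   Context: A maxset of $K_1,\ldots,K_m$ is a maximal (under inclusion) consistent subset $M\subseteq\{K_1,\ldots,K_m\}$; in a disjunction, a maxset stands for the conjunction of its formulae. A hypergraph is Berge-acyclic if there is no sequence $(E_1,v_1,\ldots,E_n,v_n)$ with $n\geq 2$, distinct hyperedges $E_i$ and distinct vertices $v_i$ such that $v_i\in E_i\cap E_{i+1}$ for $i<n$ and $v_n\in E_n\cap E_1$. A priority ordering is an ordered partition $P(1),\ldots,P(k)$ of $\{K_1,\ldots,K_m\}$ into nonempty classes. For $L,N\subseteq\{K_1,\ldots,K_m\}$, $L<N$ iff there is $i$ such that $P(j)\cap L=P(j)\cap N$ for all $j<i$ and $P(i)\cap L\supsetneq P(i)\cap N$. The result of (priority base) merging with $P$ is the disjunction of all maxsets $M$ such that no maxset $N$ satisfies $N<M$. $P$ generates $R$ if this result is equivalent to $R$; $R$ is obtainable if some priority ordering generates it. Algorithm (choices are arbitrary): 1. For each pair $K_i,K_j$, determine its consistency. 2. Set $L=\emptyset$. 3. Set $M=\{K_i,K_j\}$ where $\{K_i,K_j\}$ is consistent, $K_i\in L$ and $K_j\notin L$; if no such pair exists (e.g. $L=\emptyset$), set $M=\{K_i\}$ with $K_i\notin L$; if $L$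 contains all the $K_i$'s, stop. 4. Choose a (not yet tried) $K_j\notin M$ such that $\{K_i,K_j\}$ is consistent for every $K_i\in M$; if there is none, go to step 7. 5. If $M\cup\{K_j\}$ is inconsistent, go to step 4 and choose another $K_j$. 6. Set $M=M\cup\{K_j\}$ and go to step 4. 7. Set $L=L\cup M$. 8. If $M\models R$: (a) if no formula of $M$ is labeled, label one with $1,2$ and the others with $2$; (b) if a formula of $M$ is labeled $1,n$ and the others are unlabeled, label the others $n$; (c) if a formula is labeled $n$ and the others are unlabeled, label one of the others $1,n$ and the remaining ones $n$; (d) otherwise terminate with error. 9. If $M\not\models R$: (a) if no formula of $M$ is labeled, label all of them $2$; (b) if a formula is labeled $1,n$ and the others are unlabeled, label the others $n+1$; (c) if a formula is labeled $n$ and the others are unlabeled, label the others $n$; (d) otherwise terminate with error. 10. Go to step 3. At the end, a formula labeled $1,n$ is put in priority class $1$ and a formula labeled $n$ in class $n$ (empty classes are discarded). If the result of merging with this priority ordering is equivalent to $R$, the ordering is output and $R$ is declared obtainable; otherwise $R$ is declared not obtainable. *)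

theory Defs
  imports Main "HOL-Library.Disjoint_Sets"
begin


datatype 'a form =
    Bot
  | Top
  | Atom 'a
  | Neg "'a form"
  | And "'a form" "'a form"
  | Or "'a form" "'a form"
  | Imp "'a form" "'a form"
  | Iff "'a form" "'a form"

fun sat :: "('a \<Rightarrow> bool) \<Rightarrow> 'a form \<Rightarrow> bool" where
  "sat v Bot \<longleftrightarrow> False"
| "sat v Top \<longleftrightarrow> True"
| "sat v (Atom a) \<longleftrightarrow> v a"
| "sat v (Neg F) \<longleftrightarrow> \<not> sat v F"
| "sat v (And F G) \<longleftrightarrow> sat v F \<and> sat v G"
| "sat v (Or F G) \<longleftrightarrow> sat v F \<or> sat v G"
| "sat v (Imp F G) \<longleftrightarrow> (sat v F \<longrightarrow> sat v G)"
| "sat v (Iff F G) \<longleftrightarrow> (sat v F \<longleftrightarrow> sat v G)"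

definition consistent :: "'a form set \<Rightarrow> bool" where
  "consistent S \<longleftrightarrow> (\<exists>v. \<forall>F\<in>S. sat v F)"

definition entails :: "'a form set \<Rightarrow> 'a form \<Rightarrow> bool" where
  "entails S G \<longleftrightarrow> (\<forall>v. (\<forall>F\<in>S. sat v F) \<longrightarrow> sat v G)"

definition equivalent :: "'a form \<Rightarrow> 'a form \<Rightarrow> bool" where
  "equivalent F G \<longleftrightarrow> (\<forall>v. sat v F \<longleftrightarrow> sat v G)"

text \<open>Conjunction and disjunction of a finite set of formulae, taken in an arbitrary order;
  the order is irrelevant up to equivalence.\<close>

definition conj_of :: "'a form set \<Rightarrow> 'a form" where
  "conj_of S = foldr And (SOME Fs. set Fs = S \<and> distinct Fs) Top"

definition disj_of :: "'a form set \<Rightarrow> 'a form" where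
  "disj_of S = foldr Or (SOME Fs. set Fs = S \<and> distinct Fs) Bot"

lemma set_SOME_distinct: "finite S \<Longrightarrow> set (SOME Fs. set Fs = S \<and> distinct Fs) = S"
  by (rule someI2_ex[OF finite_distinct_list]) auto

lemma sat_conj_of:
  assumes "finite S"
  shows "sat v (conj_of S) \<longleftrightarrow> (\<forall>F\<in>S. sat v F)"
proof -
  have "sat v (foldr And Fs Top) \<longleftrightarrow> (\<forall>F\<in>set Fs. sat v F)" for Fs
    by (induction Fs) auto
  then show ?thesis
    using set_SOME_distinct[OF assms] by (simp add: conj_of_def)
qed

lemma sat_disj_of:
  assumes "finite S"
  shows "sat v (disj_of S) \<longleftrightarrow> (\<exists>F\<in>S. sat v F)"
proof -
  have "sat v (foldr Or Fs Bot) \<longleftrightarrow> (\<exists>F\<in>set Fs. sat v F)" for Fs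
    by (induction Fs) auto
  then show ?thesis
    using set_SOME_distinct[OF assms] by (simp add: disj_of_def)
qed



definition maxsets :: "'a form set \<Rightarrow> 'a form set set" where
  "maxsets Ks = {M. M \<subseteq> Ks \<and> consistent M \<and>
                    (\<forall>N. N \<subseteq> Ks \<and> consistent N \<and> M \<subseteq> N \<longrightarrow> N = M)}"

definition berge_cycle :: "'v set set \<Rightarrow> 'v set list \<Rightarrow> 'v list \<Rightarrow> bool" where
  "berge_cycle H Es vs \<longleftrightarrow>
     length Es \<ge> 2 \<and> length vs = length Es \<and> set Es \<subseteq> H \<and> distinct Es \<and> distinct vs \<and>
     (\<forall>i. Suc i < length Es \<longrightarrow> vs ! i \<in> Es ! i \<inter> Es ! Suc i) \<and>
     last vs \<in> last Es \<inter> hd Es"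

definition berge_acyclic :: "'v set set \<Rightarrow> bool" where
  "berge_acyclic H \<longleftrightarrow> \<not> (\<exists>Es vs. berge_cycle H Es vs)"



text \<open>Priority orderings are lists of classes; the list is indexed from 0, so that
  \<open>P ! i\<close> is the class of priority \<open>i + 1\<close>.\<close>

definition priority_ordering :: "'a form set \<Rightarrow> 'a form set list \<Rightarrow> bool" where
  "priority_ordering Ks P \<longleftrightarrow> distinct P \<and> partition_on Ks (set P)"

definition prio_less :: "'a form set list \<Rightarrow> 'a form set \<Rightarrow> 'a form set \<Rightarrow> bool" where
  "prio_less P L N \<longleftrightarrow>
     (\<exists>i<length P. (\<forall>j<i. P ! j \<inter> L = P ! j \<inter> N) \<and> P ! i \<inter> L \<supset> P ! i \<inter> N)"

definition merge :: "'a form set \<Rightarrow> 'a form set list \<Rightarrow> 'a form" where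
  "merge Ks P =
     disj_of (conj_of ` {M \<in> maxsets Ks. \<not> (\<exists>N\<in>maxsets Ks. prio_less P N M)})"

definition generates :: "'a form set \<Rightarrow> 'a form set list \<Rightarrow> 'a form \<Rightarrow> bool" where
  "generates Ks P R \<longleftrightarrow> equivalent (merge Ks P) R"

definition obtainable :: "'a form set \<Rightarrow> 'a form \<Rightarrow> bool" where
  "obtainable Ks R \<longleftrightarrow> (\<exists>P. priority_ordering Ks P \<and> generates Ks P R)"



text \<open>\<open>OneAnd n\<close> is the label ``\<open>1,n\<close>'' and \<open>Only n\<close> is the label ``\<open>n\<close>''.\<close>

datatype label = OneAnd nat | Only nat

type_synonym 'a labeling = "'a form \<Rightarrow> label option"

definition unlabeled :: "'a labeling \<Rightarrow> 'a form set \<Rightarrow> bool" where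
  "unlabeled lab S \<longleftrightarrow> (\<forall>F\<in>S. lab F = None)"

definition label_all :: "'a labeling \<Rightarrow> 'a form set \<Rightarrow> label \<Rightarrow> 'a labeling" where
  "label_all lab S l = (\<lambda>F. if F \<in> S then Some l else lab F)"

fun class_number :: "label \<Rightarrow> nat" where
  "class_number (OneAnd n) = 1"
| "class_number (Only n) = n"

text \<open>Only class numbers that are in use are enumerated, in increasing order; this discards
  the empty classes.\<close>

definition ordering_of :: "'a labeling \<Rightarrow> 'a form set list" where
  "ordering_of lab =
     map (\<lambda>i. {F. \<exists>l. lab F = Some l \<and> class_number l = i})
       (sorted_list_of_set (class_number ` ran lab))"

text \<open>The algorithm is a nondeterministic transition system. A state names the step about to be
  executed and carries the current values of \<open>L\<close>, \<open>M\<close>, the set \<open>T\<close> of formulae already tried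
  for extending \<open>M\<close>, the formula \<open>F\<close> under consideration, and the labeling. The last three kinds
  of state are the possible ways to terminate.\<close>

datatype 'a state =
    Step3 "'a form set" "'a labeling"
  | Step4 "'a form set" "'a form set" "'a form set" "'a labeling"
  | Step5 "'a form set" "'a form set" "'a form set" "'a form" "'a labeling"
  | Step7 "'a form set" "'a form set" "'a labeling"
  | Step8 "'a form set" "'a form set" "'a labeling"
  | Final "'a labeling"
  | Declared_Obtainable "'a form set list"
  | Declared_Not_Obtainable
  | Error

definition initial_state :: "'a state" where
  "initial_state = Step3 {} Map.empty"

text \<open>The pairwise consistency table computed by step 1 is not stored: the rules refer to
  the consistency of pairs directly. The rules named \<open>step8\<close> and \<open>step9\<close> include the jump back to
  step 3.\<close>

inductive step :: "'a form set \<Rightarrow> 'a form \<Rightarrow> 'a state \<Rightarrow> 'a state \<Rightarrow> bool"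
  for Ks :: "'a form set" and R :: "'a form" where
  step3_pair:
    "\<lbrakk>F \<in> Ks; G \<in> Ks; consistent {F, G}; F \<in> L; G \<notin> L\<rbrakk>
      \<Longrightarrow> step Ks R (Step3 L lab) (Step4 L {F, G} {} lab)"
| step3_single:
    "\<lbrakk>\<not> (\<exists>F\<in>Ks. \<exists>G\<in>Ks. consistent {F, G} \<and> F \<in> L \<and> G \<notin> L); F \<in> Ks; F \<notin> L\<rbrakk>
      \<Longrightarrow> step Ks R (Step3 L lab) (Step4 L {F} {} lab)"
| step3_stop:
    "Ks \<subseteq> L \<Longrightarrow> step Ks R (Step3 L lab) (Final lab)"
| step4_choose:
    "\<lbrakk>F \<in> Ks; F \<notin> M; F \<notin> T; \<forall>G\<in>M. consistent {G, F}\<rbrakk>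
      \<Longrightarrow> step Ks R (Step4 L M T lab) (Step5 L M (insert F T) F lab)"
| step4_none:
    "\<not> (\<exists>F\<in>Ks. F \<notin> M \<and> F \<notin> T \<and> (\<forall>G\<in>M. consistent {G, F}))
      \<Longrightarrow> step Ks R (Step4 L M T lab) (Step7 L M lab)"
| step5:
    "\<not> consistent (insert F M) \<Longrightarrow> step Ks R (Step5 L M T F lab) (Step4 L M T lab)"
| step6:
    "consistent (insert F M) \<Longrightarrow> step Ks R (Step5 L M T F lab) (Step4 L (insert F M) T lab)"
| step7:
    "step Ks R (Step7 L M lab) (Step8 (L \<union> M) M lab)"
| step8a:
    "\<lbrakk>entails M R; unlabeled lab M; F \<in> M\<rbrakk>
      \<Longrightarrow> step Ks R (Step8 L M lab)
            (Step3 L (label_all (lab(F \<mapsto> OneAnd 2)) (M - {F}) (Only 2)))"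
| step8b:
    "\<lbrakk>entails M R; F \<in> M; lab F = Some (OneAnd n); unlabeled lab (M - {F})\<rbrakk>
      \<Longrightarrow> step Ks R (Step8 L M lab) (Step3 L (label_all lab (M - {F}) (Only n)))"
| step8c:
    "\<lbrakk>entails M R; F \<in> M; lab F = Some (Only n); unlabeled lab (M - {F}); G \<in> M - {F}\<rbrakk>
      \<Longrightarrow> step Ks R (Step8 L M lab)
            (Step3 L (label_all (lab(G \<mapsto> OneAnd n)) (M - {F, G}) (Only n)))"
| step9a:
    "\<lbrakk>\<not> entails M R; unlabeled lab M\<rbrakk>
      \<Longrightarrow> step Ks R (Step8 L M lab) (Step3 L (label_all lab M (Only 2)))"
| step9b:
    "\<lbrakk>\<not> entails M R; F \<in> M; lab F = Some (OneAnd n); unlabeled lab (M - {F})\<rbrakk>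
      \<Longrightarrow> step Ks R (Step8 L M lab) (Step3 L (label_all lab (M - {F}) (Only (n + 1))))"
| step9c:
    "\<lbrakk>\<not> entails M R; F \<in> M; lab F = Some (Only n); unlabeled lab (M - {F})\<rbrakk>
      \<Longrightarrow> step Ks R (Step8 L M lab) (Step3 L (label_all lab (M - {F}) (Only n)))"
| step8d_9d:
    "\<lbrakk>\<not> unlabeled lab M; \<not> (\<exists>F\<in>M. lab F \<noteq> None \<and> unlabeled lab (M - {F}))\<rbrakk>
      \<Longrightarrow> step Ks R (Step8 L M lab) Error"
| final_yes:
    "generates Ks (ordering_of lab) R
      \<Longrightarrow> step Ks R (Final lab) (Declared_Obtainable (ordering_of lab))"
| final_no:
    "\<not> generates Ks (ordering_of lab) R
      \<Longrightarrow> step Ks R (Final lab) Declared_Not_Obtainable"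

definition reachable :: "'a form set \<Rightarrow> 'a form \<Rightarrow> 'a state \<Rightarrow> bool" where
  "reachable Ks R s \<longleftrightarrow> (step Ks R)\<^sup>*\<^sup>* initial_state s"

definition halted :: "'a form set \<Rightarrow> 'a form \<Rightarrow> 'a state \<Rightarrow> bool" where
  "halted Ks R s \<longleftrightarrow> \<not> (\<exists>s'. step Ks R s s')"

definition always_terminates :: "'a form set \<Rightarrow> 'a form \<Rightarrow> bool" where
  "always_terminates Ks R \<longleftrightarrow>
     \<not> (\<exists>\<sigma> :: nat \<Rightarrow> 'a state. \<sigma> 0 = initial_state \<and> (\<forall>i. step Ks R (\<sigma> i) (\<sigma> (Suc i))))"

end

theory Submission imports Defs begin

text \<open>
  Each model of a maxset \<open>M\<close> satisfies no formula outside \<open>M\<close>, so an ordering generating \<open>R\<close> must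
  select exactly the maxsets entailing \<open>R\<close>, and these must be jointly equivalent to \<open>R\<close>. It
  therefore suffices that the computed labeling selects exactly the maxsets entailing \<open>R\<close>, whenever
  there are any. Acyclicity makes every newly built maxset meet the formulae already treated in at
  most one formula, so labels are never in conflict: a maxset entailing \<open>R\<close> gets one formula in
  class 1 and the others in a common class \<open>n\<close>, while another maxset either has no formula
  in class 1, or shares the one it has with a maxset entailing \<open>R\<close> and has its others in class
  \<open>n + 1\<close>, where that maxset has class \<open>n\<close>.
\<close>

section \<open>Berge-acyclic hypergraphs\<close>

definition adj :: "'v set set \<Rightarrow> ('v \<times> 'v) set" where
  "adj H = {(u, w). \<exists>E\<in>H. u \<in> E \<and> w \<in> E}"

definition simple_path :: "'v set set \<Rightarrow> 'v \<Rightarrow> 'v \<Rightarrow> 'v set list \<Rightarrow> 'v list \<Rightarrow> bool" where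
  "simple_path H u w Es vs \<longleftrightarrow>
     length vs = Suc (length Es) \<and> distinct Es \<and> distinct vs \<and> set Es \<subseteq> H \<and>
     vs ! 0 = u \<and> vs ! length Es = w \<and> (\<forall>i<length Es. vs ! i \<in> Es ! i \<and> vs ! Suc i \<in> Es ! i)"

lemma sym_adj: "sym (adj H)"
  by (auto simp: adj_def sym_def)

lemma adj_rtrancl_sym: "(u, w) \<in> (adj H)\<^sup>* \<Longrightarrow> (w, u) \<in> (adj H)\<^sup>*"
  using sym_rtrancl[OF sym_adj] by (meson symD)

lemma adjI: "E \<in> H \<Longrightarrow> u \<in> E \<Longrightarrow> w \<in> E \<Longrightarrow> (u, w) \<in> adj H"
  by (auto simp: adj_def)

lemma adj_mono: "V \<subseteq> W \<Longrightarrow> (adj V)\<^sup>* \<subseteq> (adj W)\<^sup>*"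
  by (rule rtrancl_mono) (auto simp: adj_def)

lemma simple_path_take:
  assumes "simple_path H u w Es vs" "i \<le> length Es"
  shows "simple_path H u (vs ! i) (take i Es) (take (Suc i) vs)"
  using assms set_take_subset[of i Es] unfolding simple_path_def by (auto simp: min_def)

lemma simple_path_snoc:
  assumes "simple_path H u w Es vs" "E \<in> H" "w \<in> E" "w' \<in> E" "E \<notin> set Es" "w' \<notin> set vs"
  shows "simple_path H u w' (Es @ [E]) (vs @ [w'])"
  using assms unfolding simple_path_def by (auto simp: nth_append less_Suc_eq)

text \<open>Repetitions are removed by cutting: if \<open>w'\<close> is already on the path, the
  path is cut there; if \<open>E\<close> was used at position \<open>i\<close>, the path is cut at
  \<open>vs ! i\<close>, which lies in \<open>E\<close>, and \<open>E\<close> then leads directly to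
  \<open>w'\<close>.\<close>

lemma simple_path_step:
  assumes p: "simple_path H u w Es vs" and E: "E \<in> H" "w \<in> E" "w' \<in> E"
  shows "\<exists>Es vs. simple_path H u w' Es vs"
proof (cases "w' \<in> set vs")
  case True
  then obtain i where i: "i < length vs" "vs ! i = w'"
    by (auto simp: in_set_conv_nth)
  with p have "i \<le> length Es" by (auto simp: simple_path_def)
  with simple_path_take[OF p] i show ?thesis by blast
next
  case new: False
  show ?thesis
  proof (cases "E \<in> set Es")
    case True
    then obtain i where i: "i < length Es" "Es ! i = E"
      by (auto simp: in_set_conv_nth)
    have q: "simple_path H u (vs ! i) (take i Es) (take (Suc i) vs)"
      using simple_path_take[OF p] i by simp
    have "vs ! i \<in> E" and "distinct Es"
      using p i by (auto simp: simple_path_def)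
    moreover have "E \<notin> set (take i Es)"
      using i \<open>distinct Es\<close> by (auto simp: in_set_conv_nth nth_eq_iff_index_eq)
    moreover have "w' \<notin> set (take (Suc i) vs)"
      using new by (meson in_set_takeD)
    ultimately show ?thesis using simple_path_snoc[OF q] E by blast
  next
    case False
    then show ?thesis using simple_path_snoc[OF p] E new by blast
  qed
qed

lemma simple_path_exists:
  assumes "(u, w) \<in> (adj H)\<^sup>*"
  shows "\<exists>Es vs. simple_path H u w Es vs"
  using assms
proof (induction rule: rtrancl_induct)
  case base
  have "simple_path H u u [] [u]" by (simp add: simple_path_def)
  then show ?case by blast
next
  case (step w w')
  then show ?case by (auto simp: adj_def dest: simple_path_step)
qed

text \<open>Were \<open>u\<close> and \<open>w\<close> distinct, a simple path between them in
  \<open>V\<close> would be closed to a Berge cycle by \<open>M\<close>, which is not one of its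
  edges because \<open>M \<notin> V\<close>.\<close>

lemma berge_acyclic_closing_edge:
  assumes acyclic: "berge_acyclic H" and "V \<subseteq> H" "M \<in> H" "M \<notin> V" "u \<in> M" "w \<in> M"
    and "(u, w) \<in> (adj V)\<^sup>*"
  shows "u = w"
proof (rule ccontr)
  assume "u \<noteq> w"
  obtain Es vs where p: "simple_path V u w Es vs"
    using simple_path_exists[OF assms(7)] by blast
  have ne: "Es \<noteq> []" using p \<open>u \<noteq> w\<close> by (auto simp: simple_path_def)
  have vs: "vs = u # tl vs"
    using p by (cases vs) (auto simp: simple_path_def)
  have tl: "tl vs ! i = vs ! Suc i" if "i < length Es" for i
    using p that by (simp add: simple_path_def nth_tl)
  \<comment> \<open>In a Berge cycle, vertex \<open>i\<close> joins edge \<open>i\<close> to the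
    next edge. The start \<open>u\<close> is therefore moved to the end of the vertex list, where it
    joins \<open>M\<close> to the first edge.\<close>
  have "berge_cycle H (Es @ [M]) (tl vs @ [u])"
    unfolding berge_cycle_def
  proof (intro conjI allI impI)
    show "2 \<le> length (Es @ [M])" using ne by (cases Es) auto
    show "length (tl vs @ [u]) = length (Es @ [M])"
      using p by (simp add: simple_path_def)
    show "set (Es @ [M]) \<subseteq> H" "distinct (Es @ [M])"
      using p assms by (auto simp: simple_path_def)
    have "distinct vs" using p by (simp add: simple_path_def)
    then show "distinct (tl vs @ [u])" by (subst (asm) vs) auto
    have "u \<in> hd Es"
      using p ne by (auto simp: simple_path_def hd_conv_nth)
    then show "last (tl vs @ [u]) \<in> last (Es @ [M]) \<inter> hd (Es @ [M])"
      using ne assms by simp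
    fix i assume "Suc i < length (Es @ [M])"
    then have i: "i < length Es" by simp
    then have "vs ! Suc i \<in> Es ! i" using p by (auto simp: simple_path_def)
    moreover have "vs ! Suc i \<in> (Es @ [M]) ! Suc i"
    proof (cases "Suc i < length Es")
      case True
      then show ?thesis using p by (auto simp: simple_path_def nth_append)
    next
      case False
      then have "Suc i = length Es" using i by simp
      then show ?thesis using p \<open>w \<in> M\<close> by (auto simp: simple_path_def nth_append)
    qed
    moreover have "(tl vs @ [u]) ! i = vs ! Suc i"
      using tl[OF i] i p by (simp add: simple_path_def nth_append)
    ultimately show "(tl vs @ [u]) ! i \<in> (Es @ [M]) ! i \<inter> (Es @ [M]) ! Suc i"
      using i by (simp add: nth_append)
  qed
  with acyclic show False by (auto simp: berge_acyclic_def)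
qed

section \<open>Maxsets and merging\<close>

lemma consistent_mono: "consistent S \<Longrightarrow> T \<subseteq> S \<Longrightarrow> consistent T"
  by (auto simp: consistent_def)

lemma maxsets_maximal:
  "M \<in> maxsets Ks \<Longrightarrow> N \<subseteq> Ks \<Longrightarrow> consistent N \<Longrightarrow> M \<subseteq> N \<Longrightarrow> N = M"
  by (simp add: maxsets_def)

lemma maxsets_subset_eq:
  "M \<in> maxsets Ks \<Longrightarrow> N \<in> maxsets Ks \<Longrightarrow> M \<subseteq> N \<Longrightarrow> M = N"
  by (auto simp: maxsets_def)

lemma maxsets_extend:
  assumes "finite Ks" "S \<subseteq> Ks" "consistent S"
  shows "\<exists>M\<in>maxsets Ks. S \<subseteq> M"
proof -
  let ?A = "{N. S \<subseteq> N \<and> N \<subseteq> Ks \<and> consistent N}"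
  have "finite ?A" using assms(1) by (simp add: finite_subset[of _ "Pow Ks"] subset_iff)
  moreover have "S \<in> ?A" using assms by simp
  ultimately obtain M where "M \<in> ?A" "\<forall>N\<in>?A. M \<subseteq> N \<longrightarrow> M = N"
    using finite_has_maximal2[of ?A S] by fastforce
  then have "M \<in> maxsets Ks" "S \<subseteq> M" unfolding maxsets_def by blast+
  then show ?thesis by blast
qed

text \<open>The formulae of \<open>Ks\<close> true in a model of \<open>M\<close> form a consistent
  superset of \<open>M\<close>, hence are \<open>M\<close> itself. A member of \<open>W\<close> true
  in that model lies inside \<open>M\<close>, and maximality makes the two equal.\<close>

lemma maxset_entails_disjunction:
  assumes M: "M \<in> maxsets Ks" and W: "W \<subseteq> maxsets Ks"
    and "\<And>v. (\<forall>F\<in>M. sat v F) \<Longrightarrow> \<exists>N\<in>W. \<forall>F\<in>N. sat v F"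
  shows "M \<in> W"
proof -
  obtain v where v: "\<forall>F\<in>M. sat v F"
    using M by (auto simp: maxsets_def consistent_def)
  then obtain N where N: "N \<in> W" "\<forall>F\<in>N. sat v F" using assms(3) by blast
  let ?X = "{F \<in> Ks. sat v F}"
  have "consistent ?X" by (auto simp: consistent_def)
  moreover have "M \<subseteq> ?X" using v M by (auto simp: maxsets_def)
  ultimately have "?X = M" using maxsets_maximal[OF M] by simp
  moreover have "N \<subseteq> ?X" using N W by (auto simp: maxsets_def)
  ultimately show ?thesis using maxsets_subset_eq[of N Ks M] N M W by auto
qed

definition selected :: "'a form set \<Rightarrow> 'a form set list \<Rightarrow> 'a form set set" where
  "selected Ks P = {M \<in> maxsets Ks. \<not> (\<exists>N\<in>maxsets Ks. prio_less P N M)}"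

lemma generates_iff:
  assumes "finite Ks"
  shows "generates Ks P R \<longleftrightarrow> (\<forall>v. (\<exists>M\<in>selected Ks P. \<forall>F\<in>M. sat v F) \<longleftrightarrow> sat v R)"
proof -
  have sub: "selected Ks P \<subseteq> Pow Ks"
    by (auto simp: selected_def maxsets_def)
  then have fin: "finite (selected Ks P)" and "M \<in> selected Ks P \<Longrightarrow> finite M" for M
    using assms by (auto intro: finite_subset)
  then have "sat v (merge Ks P) \<longleftrightarrow> (\<exists>M\<in>selected Ks P. \<forall>F\<in>M. sat v F)" for v
    unfolding merge_def selected_def[symmetric] by (simp add: sat_disj_of sat_conj_of)
  then show ?thesis by (simp add: generates_def equivalent_def)
qed

text \<open>Each disjunct entails the merging result; conversely, a maxset entailing
  \<open>R\<close> entails the disjunction and so is one of the disjuncts. The selection is thus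
  determined by \<open>R\<close>, whichever generating \<open>P\<close> is taken.\<close>

lemma selected_if_generates:
  assumes "finite Ks" and gen: "generates Ks P R"
  shows "selected Ks P = {M \<in> maxsets Ks. entails M R}"
proof -
  have sat: "(\<exists>M\<in>selected Ks P. \<forall>F\<in>M. sat v F) \<longleftrightarrow> sat v R" for v
    using gen generates_iff[OF assms(1)] by blast
  have sub: "selected Ks P \<subseteq> maxsets Ks" by (auto simp: selected_def)
  have "M \<in> selected Ks P" if "M \<in> maxsets Ks" "entails M R" for M
    using maxset_entails_disjunction[OF that(1) sub] that(2) sat
    unfolding entails_def by blast
  moreover have "entails M R" if "M \<in> selected Ks P" for M
    using sat that unfolding entails_def by blast
  ultimately show ?thesis using sub by auto
qed

section \<open>Priority orderings from labelings\<close>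

text \<open>Indexed by the class number itself and possibly empty, in contrast to the positions in
  the list of nonempty classes.\<close>

definition label_class :: "'a labeling \<Rightarrow> nat \<Rightarrow> 'a form set" where
  "label_class lab i = {F. \<exists>l. lab F = Some l \<and> class_number l = i}"

text \<open>Any two sets agree on an empty class, so indices outside \<open>ks\<close> never matter;
  as \<open>ks\<close> increases strictly, positions and class numbers are ordered alike.\<close>

lemma prio_less_map_iff:
  fixes ks :: "nat list"
  assumes sorted: "sorted_wrt (<) ks" and used: "\<And>i. C i \<noteq> {} \<Longrightarrow> i \<in> set ks"
  shows "prio_less (map C ks) A B \<longleftrightarrow>
    (\<exists>i. (\<forall>j<i. C j \<inter> A = C j \<inter> B) \<and> C i \<inter> A \<supset> C i \<inter> B)"
proof
  assume "prio_less (map C ks) A B"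
  then obtain p where p: "p < length ks" "\<forall>q<p. C (ks ! q) \<inter> A = C (ks ! q) \<inter> B"
    "C (ks ! p) \<inter> A \<supset> C (ks ! p) \<inter> B"
    unfolding prio_less_def by (metis (no_types, lifting) length_map nth_map order_less_trans)
  have "C j \<inter> A = C j \<inter> B" if "j < ks ! p" for j
  proof (cases "j \<in> set ks")
    case True
    then obtain q where q: "q < length ks" "ks ! q = j" by (auto simp: in_set_conv_nth)
    have "q < p"
    proof (rule ccontr)
      assume "\<not> q < p"
      then have "p = q \<or> p < q" by auto
      then have "ks ! p \<le> ks ! q"
        using sorted_wrt_nth_less[OF sorted, of p q] q(1) by auto
      then show False using q(2) that by simp
    qed
    then show ?thesis using p q by auto
  next
    case False
    then show ?thesis using used by auto
  qed
  then show "\<exists>i. (\<forall>j<i. C j \<inter> A = C j \<inter> B) \<and> C i \<inter> A \<supset> C i \<inter> B"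
    using p by blast
next
  assume "\<exists>i. (\<forall>j<i. C j \<inter> A = C j \<inter> B) \<and> C i \<inter> A \<supset> C i \<inter> B"
  then obtain i where i: "\<forall>j<i. C j \<inter> A = C j \<inter> B" "C i \<inter> A \<supset> C i \<inter> B" by blast
  then have "C i \<noteq> {}" by blast
  then obtain p where p: "p < length ks" "ks ! p = i"
    using used by (metis in_set_conv_nth)
  have "ks ! q < i" if "q < p" for q
    using sorted_wrt_nth_less[OF sorted that] p by simp
  then show "prio_less (map C ks) A B"
    unfolding prio_less_def using p i by (intro exI[of _ p]) auto
qed

lemma ordering_of_alt:
  "ordering_of lab = map (label_class lab) (sorted_list_of_set (class_number ` ran lab))"
  by (simp add: ordering_of_def label_class_def[abs_def])

lemma label_class_nonempty_iff: "label_class lab i \<noteq> {} \<longleftrightarrow> i \<in> class_number ` ran lab"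
  by (force simp: label_class_def ran_def)

lemma prio_less_ordering_of:
  assumes "finite (dom lab)"
  shows "prio_less (ordering_of lab) A B \<longleftrightarrow>
    (\<exists>i. (\<forall>j<i. label_class lab j \<inter> A = label_class lab j \<inter> B) \<and>
         label_class lab i \<inter> A \<supset> label_class lab i \<inter> B)"
  unfolding ordering_of_alt
  using assms finite_ran[OF assms] label_class_nonempty_iff[of lab]
  by (intro prio_less_map_iff) auto

lemma priority_ordering_ordering_of:
  assumes fin: "finite (dom lab)"
  shows "priority_ordering (dom lab) (ordering_of lab)"
proof -
  let ?I = "class_number ` ran lab"
  have fin: "finite ?I" using finite_ran[OF fin] by simp
  have inj: "inj_on (label_class lab) ?I"
  proof (rule inj_onI)
    fix i j assume "i \<in> ?I" "j \<in> ?I" "label_class lab i = label_class lab j"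
    then obtain F where "F \<in> label_class lab i" "F \<in> label_class lab j"
      using label_class_nonempty_iff[of lab i] by blast
    then show "i = j" by (auto simp: label_class_def)
  qed
  have "distinct (ordering_of lab)"
    using fin inj by (simp add: ordering_of_alt distinct_map)
  moreover have "partition_on (dom lab) (label_class lab ` ?I)"
  proof (rule partition_onI)
    show "\<Union> (label_class lab ` ?I) = dom lab"
      by (force simp: label_class_def ran_def)
    show "{} \<notin> label_class lab ` ?I"
      using label_class_nonempty_iff[of lab] by blast
    show "disjnt p q" if "p \<in> label_class lab ` ?I" "q \<in> label_class lab ` ?I" "p \<noteq> q" for p q
      using that by (auto simp: label_class_def disjnt_def)
  qed
  ultimately show ?thesis using fin by (simp add: priority_ordering_def ordering_of_alt)
qed

section \<open>Termination\<close>

text \<open>The first component drops when step 3 starts an \<open>M\<close> containing a formula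
  outside \<open>L\<close>. Within a round, each untried formula counts twice in the second
  component, so that choosing one pays for the larger constant of step 5; the other constants follow
  the order of the steps.\<close>

fun step_measure :: "'a form set \<Rightarrow> 'a state \<Rightarrow> nat \<times> nat" where
  "step_measure Ks (Step3 L lab) = (card (Ks - L), 2)"
| "step_measure Ks (Step4 L M T lab) = (card (Ks - (L \<union> M)), 2 * card (Ks - T) + 5)"
| "step_measure Ks (Step5 L M T F lab) = (card (Ks - (L \<union> M)), 2 * card (Ks - T) + 6)"
| "step_measure Ks (Step7 L M lab) = (card (Ks - (L \<union> M)), 4)"
| "step_measure Ks (Step8 L M lab) = (card (Ks - L), 3)"
| "step_measure Ks (Final lab) = (0, 1)"
| "step_measure Ks _ = (0, 0)"

lemma step_decreases:
  assumes fin: "finite Ks" and "step Ks R s s'"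
  shows "(step_measure Ks s', step_measure Ks s) \<in> less_than <*lex*> less_than"
  using assms(2)
proof cases
  case (step3_pair F G L lab)
  have "card (Ks - (L \<union> {F, G})) < card (Ks - L)"
    using step3_pair fin by (intro psubset_card_mono) auto
  with step3_pair show ?thesis by simp
next
  case (step3_single L F lab)
  have "card (Ks - (L \<union> {F})) < card (Ks - L)"
    using step3_single fin by (intro psubset_card_mono) auto
  with step3_single show ?thesis by simp
next
  case (step4_choose F M T L lab)
  have "card (Ks - insert F T) < card (Ks - T)"
    using step4_choose fin by (intro psubset_card_mono) auto
  with step4_choose show ?thesis by simp
next
  case (step6 F M L T lab)
  \<comment> \<open>Equality is possible, since \<open>F\<close> may already lie in
    \<open>L\<close>; then the second component decreases.\<close>
  have "card (Ks - (L \<union> insert F M)) \<le> card (Ks - (L \<union> M))"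
    using fin by (intro card_mono) auto
  with step6 show ?thesis by auto
qed auto

lemma always_terminates_if_finite:
  assumes "finite Ks"
  shows "always_terminates Ks R"
proof -
  have "wf (less_than <*lex*> less_than)" by auto
  then have "\<not> (\<exists>f. \<forall>i. (f (Suc i), f i) \<in> less_than <*lex*> less_than)"
    by (simp add: wf_iff_no_infinite_down_chain)
  moreover have "(step_measure Ks (\<sigma> (Suc i)), step_measure Ks (\<sigma> i)) \<in> less_than <*lex*> less_than"
    if "\<forall>i. step Ks R (\<sigma> i) (\<sigma> (Suc i))" for \<sigma> i
    using step_decreases[OF assms] that by blast
  ultimately have "\<not> (\<forall>i. step Ks R (\<sigma> i) (\<sigma> (Suc i)))" for \<sigma>
    by (meson exI[of _ "\<lambda>i. step_measure Ks (\<sigma> i)"])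
  then show ?thesis by (auto simp: always_terminates_def)
qed

section \<open>The invariant of the algorithm\<close>

lemma map_le_label_all: "unlabeled lab S \<Longrightarrow> lab \<subseteq>\<^sub>m label_all lab S l"
  by (auto simp: map_le_def label_all_def unlabeled_def)

lemma map_le_label_all_upd:
  assumes "unlabeled lab (insert G S)"
  shows "lab \<subseteq>\<^sub>m label_all (lab(G \<mapsto> k)) S l"
  using assms by (auto simp: map_le_def label_all_def unlabeled_def)

lemma dom_label_all: "dom (label_all lab S l) = dom lab \<union> S"
  by (auto simp: label_all_def split: if_splits)

text \<open>Two numbers are kept apart: \<open>n\<close> is the one in the label of
  \<open>G\<close>, \<open>k\<close> is the class of the other formulae. A maxset entailing
  \<open>R\<close> will have \<open>k = n\<close>, any other one \<open>k = n + 1\<close>.\<close>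

definition labeled_1n :: "'a labeling \<Rightarrow> 'a form set \<Rightarrow> 'a form \<Rightarrow> nat \<Rightarrow> nat \<Rightarrow> bool" where
  "labeled_1n lab M G n k \<longleftrightarrow> G \<in> M \<and> n \<ge> 2 \<and> lab G = Some (OneAnd n) \<and>
     (\<forall>F\<in>M - {G}. lab F = Some (Only k))"

lemma labeled_1n_unique:
  assumes "labeled_1n lab M G n k" "H \<in> M" "lab H = Some (OneAnd j)"
  shows "H = G" "j = n"
proof -
  show "H = G" using assms by (cases "H = G") (auto simp: labeled_1n_def)
  then show "j = n" using assms by (auto simp: labeled_1n_def)
qed

lemma label_class_labeled_1n:
  assumes "labeled_1n lab M G n k"
  shows "label_class lab j \<inter> M = (if j = 1 then {G} else {}) \<union> (if j = k then M - {G} else {})"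
proof -
  have lab: "lab G = Some (OneAnd n)" "G \<in> M" "\<And>F. F \<in> M \<Longrightarrow> F \<noteq> G \<Longrightarrow> lab F = Some (Only k)"
    using assms by (auto simp: labeled_1n_def)
  show ?thesis
  proof (rule set_eqI)
    fix F
    show "F \<in> label_class lab j \<inter> M \<longleftrightarrow>
      F \<in> (if j = 1 then {G} else {}) \<union> (if j = k then M - {G} else {})"
      using lab by (cases "F \<in> M"; cases "F = G") (auto simp: label_class_def)
  qed
qed

text \<open>A maxset not entailing \<open>R\<close> must lose: either it has nothing in class 1, or
  its formula in class 1 is \<open>G\<close> and its other formulae come one class too late.\<close>

definition well_labeled :: "'a form \<Rightarrow> 'a labeling \<Rightarrow> 'a form set \<Rightarrow> bool" where
  "well_labeled R lab M \<longleftrightarrow>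
     (if entails M R then \<exists>G n. labeled_1n lab M G n n
      else (\<forall>F\<in>M. \<exists>n\<ge>2. lab F = Some (Only n)) \<or> (\<exists>G n. labeled_1n lab M G n (n + 1)))"

text \<open>Labels are added but never changed, so maxsets treated earlier stay well
  labeled.\<close>

lemma well_labeled_mono:
  assumes "well_labeled R lab M" "lab \<subseteq>\<^sub>m lab'"
  shows "well_labeled R lab' M"
proof -
  have ext: "lab F = Some l \<Longrightarrow> lab' F = Some l" for F l
    using assms(2) by (metis domI map_le_def)
  have "labeled_1n lab M G n k \<Longrightarrow> labeled_1n lab' M G n k" for G n k
    using ext by (auto simp: labeled_1n_def)
  then show ?thesis using assms(1) ext
    unfolding well_labeled_def by (auto split: if_splits) blast+
qed

lemma well_labeled_ge2:
  assumes "well_labeled R lab M" "F \<in> M" "lab F = Some (OneAnd n) \<or> lab F = Some (Only n)"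
  shows "n \<ge> 2"
  using assms
  by (cases "entails M R"; cases "lab F") (force simp: well_labeled_def labeled_1n_def)+

text \<open>Class 0 is thus empty, which makes class 1 the first that can distinguish two
  maxsets.\<close>

lemma well_labeled_class_pos:
  assumes "well_labeled R lab M" "F \<in> M" "lab F = Some l"
  shows "class_number l > 0"
  using well_labeled_ge2[OF assms(1,2)] assms(3) by (cases l) fastforce+

text \<open>\<open>V\<close> collects the maxsets treated so far. The connectivity clause makes
  acyclicity applicable to a maxset outside \<open>V\<close>: treated formulae that are connected at
  all are connected through \<open>V\<close>. The last clause provides, for each label
  \<open>OneAnd n\<close>, a competitor that entails \<open>R\<close>.\<close>

definition covered :: "'a form set \<Rightarrow> 'a form \<Rightarrow> 'a form set set \<Rightarrow> 'a labeling \<Rightarrow> bool" where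
  "covered Ks R V lab \<longleftrightarrow>
     V \<subseteq> maxsets Ks \<and> dom lab = \<Union>V \<and>
     (\<forall>u\<in>\<Union>V. \<forall>w\<in>\<Union>V. (u, w) \<in> (adj (maxsets Ks))\<^sup>* \<longrightarrow> (u, w) \<in> (adj V)\<^sup>*) \<and>
     (\<forall>M\<in>V. well_labeled R lab M) \<and>
     (\<forall>G n. lab G = Some (OneAnd n) \<longrightarrow> (\<exists>N\<in>V. G \<in> N \<and> entails N R))"

text \<open>The disjunction reflects the preference in step 3: a set disjoint from \<open>L\<close>
  is started only when no consistent pair leads out of \<open>L\<close>.\<close>

definition expandable :: "'a form set \<Rightarrow> 'a form set \<Rightarrow> 'a form set \<Rightarrow> bool" where
  "expandable Ks L M \<longleftrightarrow> M \<subseteq> Ks \<and> consistent M \<and> \<not> M \<subseteq> L \<and>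
     (M \<inter> L \<noteq> {} \<or> \<not> (\<exists>F\<in>Ks. \<exists>G\<in>Ks. consistent {F, G} \<and> F \<in> L \<and> G \<notin> L))"

text \<open>States store only the union \<open>L\<close> of the treated maxsets, so their family is
  recovered existentially.\<close>

definition loop_inv :: "'a form set \<Rightarrow> 'a form \<Rightarrow> 'a form set \<Rightarrow> 'a labeling \<Rightarrow> bool" where
  "loop_inv Ks R L lab \<longleftrightarrow> (\<exists>V. L = \<Union>V \<and> covered Ks R V lab)"

text \<open>A tried formula is in \<open>M\<close> or contradicts it, hence exhausting the
  candidates makes \<open>M\<close> maximal; in step 5 the current \<open>F\<close> is exempt, being
  undecided. In step 8, \<open>L'\<close> already contains \<open>M\<close> while the labeling still
  belongs to the earlier \<open>L\<close>.\<close>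

fun invariant :: "'a form set \<Rightarrow> 'a form \<Rightarrow> 'a state \<Rightarrow> bool" where
  "invariant Ks R (Step3 L lab) \<longleftrightarrow> loop_inv Ks R L lab"
| "invariant Ks R (Step4 L M T lab) \<longleftrightarrow> loop_inv Ks R L lab \<and> expandable Ks L M \<and>
     (\<forall>F\<in>T. F \<in> M \<or> \<not> consistent (insert F M))"
| "invariant Ks R (Step5 L M T F lab) \<longleftrightarrow> loop_inv Ks R L lab \<and> expandable Ks L M \<and> F \<in> Ks \<and>
     (\<forall>G\<in>T. G = F \<or> G \<in> M \<or> \<not> consistent (insert G M))"
| "invariant Ks R (Step7 L M lab) \<longleftrightarrow> loop_inv Ks R L lab \<and> expandable Ks L M \<and> M \<in> maxsets Ks"
| "invariant Ks R (Step8 L' M lab) \<longleftrightarrow>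
     (\<exists>L. L' = L \<union> M \<and> loop_inv Ks R L lab \<and> expandable Ks L M \<and> M \<in> maxsets Ks)"
| "invariant Ks R (Final lab) \<longleftrightarrow> (\<exists>L. loop_inv Ks R L lab \<and> Ks \<subseteq> L)"
| "invariant Ks R (Declared_Obtainable P) \<longleftrightarrow>
     obtainable Ks R \<and> priority_ordering Ks P \<and> generates Ks P R"
| "invariant Ks R Declared_Not_Obtainable \<longleftrightarrow> \<not> obtainable Ks R"
| "invariant Ks R Error \<longleftrightarrow> False"

section \<open>Connectivity and overlap of maxsets\<close>

locale acyclic_merging =
  fixes Ks :: "'a form set" and R :: "'a form"
  assumes finite_Ks: "finite Ks"
    and consistent_single: "F \<in> Ks \<Longrightarrow> consistent {F}"
    and consistent_R: "consistent {R}"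
    and acyclic: "berge_acyclic (maxsets Ks)"
begin

text \<open>A consistent pair extends to a maxset. This ties the pairwise tests of the algorithm to
  connectivity in the hypergraph.\<close>

lemma adj_maxsets:
  assumes "F \<in> Ks" "G \<in> Ks"
  shows "(F, G) \<in> adj (maxsets Ks) \<longleftrightarrow> consistent {F, G}"
proof
  assume "(F, G) \<in> adj (maxsets Ks)"
  then obtain M where "M \<in> maxsets Ks" "{F, G} \<subseteq> M" by (auto simp: adj_def)
  then show "consistent {F, G}"
    using consistent_mono unfolding maxsets_def by blast
next
  assume "consistent {F, G}"
  then show "(F, G) \<in> adj (maxsets Ks)"
    using maxsets_extend[OF finite_Ks, of "{F, G}"] assms by (auto simp: adj_def)
qed

text \<open>Two common formulae would form a Berge cycle of length 2: \<open>N\<close> alone is a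
  path between them, and \<open>M\<close> closes it.\<close>

lemma maxsets_meet_once:
  assumes "M \<in> maxsets Ks" "N \<in> maxsets Ks" "M \<noteq> N" "F \<in> M \<inter> N" "G \<in> M \<inter> N"
  shows "F = G"
  using assms by (intro berge_acyclic_closing_edge[OF acyclic, of "{N}" M])
    (auto intro!: r_into_rtrancl adjI)

text \<open>\<open>M\<close> connects \<open>F\<close> and \<open>G\<close> in the whole hypergraph,
  hence \<open>V\<close> connects them as well, and \<open>M\<close>, lying outside
  \<open>V\<close>, would close a cycle if they differed.\<close>

lemma maxset_meets_covered_once:
  assumes V: "covered Ks R V lab" and M: "M \<in> maxsets Ks" "M \<notin> V"
    and "F \<in> M" "F \<in> \<Union>V" "G \<in> M" "G \<in> \<Union>V"
  shows "F = G"
proof -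
  have "(F, G) \<in> (adj (maxsets Ks))\<^sup>*"
    using M(1) \<open>F \<in> M\<close> \<open>G \<in> M\<close> by (intro r_into_rtrancl adjI)
  then have "(F, G) \<in> (adj V)\<^sup>*" "V \<subseteq> maxsets Ks"
    using V assms(5,7) unfolding covered_def by blast+
  then show ?thesis
    using berge_acyclic_closing_edge[OF acyclic] assms by blast
qed

text \<open>When step 3 finds no pair, \<open>L\<close> contains every connected component that it
  meets.\<close>

lemma adj_closed:
  assumes closed: "\<not> (\<exists>F\<in>Ks. \<exists>G\<in>Ks. consistent {F, G} \<and> F \<in> L \<and> G \<notin> L)"
    and "(u, w) \<in> (adj (maxsets Ks))\<^sup>*" "u \<in> L"
  shows "w \<in> L"
  using assms(2,3)
proof (induction rule: rtrancl_induct)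
  case (step y z)
  then obtain M where "M \<in> maxsets Ks" "y \<in> M" "z \<in> M" by (auto simp: adj_def)
  then have "y \<in> Ks" "z \<in> Ks" by (auto simp: maxsets_def)
  then show ?case using closed step adj_maxsets by blast
qed simp

text \<open>The point is connectivity between an old formula \<open>u\<close> and some
  \<open>w\<close> in \<open>M\<close>: a formula \<open>F\<close> shared by \<open>M\<close> and
  \<open>\<Union>V\<close> is already connected to \<open>u\<close> through \<open>V\<close>, and
  \<open>M\<close> joins \<open>F\<close> to \<open>w\<close>. The condition \<open>fresh\<close>
  concerns new formulae because old ones keep their witnesses.\<close>

lemma covered_insert:
  assumes V: "covered Ks R V lab" and M: "M \<in> maxsets Ks" and exp: "expandable Ks (\<Union>V) M"
    and le: "lab \<subseteq>\<^sub>m lab'" and dom: "dom lab' = \<Union>V \<union> M" and wl: "well_labeled R lab' M"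
    and fresh: "\<And>G n. G \<in> M \<Longrightarrow> G \<notin> \<Union>V \<Longrightarrow> lab' G = Some (OneAnd n) \<Longrightarrow> entails M R"
  shows "covered Ks R (insert M V) lab'"
proof -
  let ?H = "maxsets Ks"
  have conn: "(u, w) \<in> (adj V)\<^sup>*" if "u \<in> \<Union>V" "w \<in> \<Union>V" "(u, w) \<in> (adj ?H)\<^sup>*" for u w
    using V that unfolding covered_def by blast
  have half: "(u, w) \<in> (adj (insert M V))\<^sup>*"
    if uw: "u \<in> \<Union>V" "w \<in> M" "(u, w) \<in> (adj ?H)\<^sup>*" for u w
  proof (cases "M \<inter> \<Union>V = {}")
    case True
    \<comment> \<open>Since \<open>M\<close> is disjoint from \<open>\<Union>V\<close>, no
      consistent pair leaves \<open>\<Union>V\<close>; a connection to \<open>w\<close> would put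
      \<open>w\<close> into both sets, so this case is void.\<close>
    then have "w \<in> \<Union>V"
      using exp adj_closed[OF _ uw(3,1)] unfolding expandable_def by blast
    then show ?thesis using True uw by blast
  next
    case False
    then obtain F where F: "F \<in> M" "F \<in> \<Union>V" by blast
    have "(u, F) \<in> (adj ?H)\<^sup>*"
      using uw(3) adjI[OF M uw(2) F(1)] by (rule rtrancl_into_rtrancl)
    then have "(u, F) \<in> (adj (insert M V))\<^sup>*"
      using conn uw(1) F(2) adj_mono[of V "insert M V"] by blast
    moreover have "(F, w) \<in> adj (insert M V)" using F uw by (intro adjI) auto
    ultimately show ?thesis by (rule rtrancl_into_rtrancl)
  qed
  have "(u, w) \<in> (adj (insert M V))\<^sup>*"
    if "u \<in> \<Union>(insert M V)" "w \<in> \<Union>(insert M V)" "(u, w) \<in> (adj ?H)\<^sup>*" for u w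
  proof -
    consider "u \<in> \<Union>V" "w \<in> \<Union>V" | "u \<in> \<Union>V" "w \<in> M" | "u \<in> M" "w \<in> \<Union>V" | "u \<in> M" "w \<in> M"
      using \<open>u \<in> _\<close> \<open>w \<in> _\<close> by blast
    then show ?thesis
    proof cases
      case 1
      then show ?thesis using conn that adj_mono[of V "insert M V"] by blast
    next
      case 2
      then show ?thesis using half that by blast
    next
      case 3
      then show ?thesis using half that adj_rtrancl_sym by metis
    next
      case 4
      then show ?thesis by (intro r_into_rtrancl adjI) auto
    qed
  qed
  moreover have "\<exists>N\<in>insert M V. G \<in> N \<and> entails N R" if G: "lab' G = Some (OneAnd n)" for G n
  proof (cases "G \<in> dom lab")
    case True
    then have "lab G = Some (OneAnd n)" using le G by (metis map_le_def)
    then show ?thesis using V unfolding covered_def by blast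
  next
    case False
    then have new: "G \<in> M" "G \<notin> \<Union>V" using V dom G by (auto simp: covered_def)
    then show ?thesis using new fresh G by blast
  qed
  ultimately show ?thesis
    using V M dom wl well_labeled_mono[OF _ le] by (auto simp: covered_def)
qed

lemma loop_inv_label:
  assumes "loop_inv Ks R L lab" "expandable Ks L M" "M \<in> maxsets Ks"
    and "lab \<subseteq>\<^sub>m lab'" "dom lab' = L \<union> M" "well_labeled R lab' M"
    and "\<And>G n. G \<in> M \<Longrightarrow> lab G = None \<Longrightarrow> lab' G = Some (OneAnd n) \<Longrightarrow> entails M R"
  shows "loop_inv Ks R (L \<union> M) lab'"
proof -
  obtain V where V: "L = \<Union>V" "covered Ks R V lab"
    using assms(1) by (auto simp: loop_inv_def)
  then have "dom lab = \<Union>V" by (simp add: covered_def)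
  then have "covered Ks R (insert M V) lab'"
    using assms V by (intro covered_insert[OF V(2)]) (blast | simp)+
  then show ?thesis
    using V by (auto simp: loop_inv_def intro!: exI[of _ "insert M V"])
qed

lemma loop_inv_dom: "loop_inv Ks R L lab \<Longrightarrow> dom lab = L"
  by (auto simp: loop_inv_def covered_def)

lemma loop_inv_ge2:
  assumes "loop_inv Ks R L lab" "lab F = Some (OneAnd n) \<or> lab F = Some (Only n)"
  shows "n \<ge> 2"
proof -
  obtain V where V: "covered Ks R V lab" using assms by (auto simp: loop_inv_def)
  then obtain M where "M \<in> V" "F \<in> M" using assms(2) unfolding covered_def by blast
  then show ?thesis using V assms(2) well_labeled_ge2[of R lab M F n] by (auto simp: covered_def)
qed

text \<open>A maxset not inside \<open>L\<close> shares at most one formula with \<open>L\<close>,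
  the set of labeled formulae. So one of the cases (a) to (c) of steps 8 and 9 always applies;
  \<open>G\<close> is the further formula on which step 8c puts its label.\<close>

lemma new_maxset_cases:
  assumes L: "loop_inv Ks R L lab" and exp: "expandable Ks L M" and M: "M \<in> maxsets Ks"
  obtains (none) "unlabeled lab M" "M \<noteq> {}"
  | (one) F l G where "F \<in> M" "lab F = Some l" "unlabeled lab (M - {F})" "G \<in> M - {F}"
proof (cases "M \<inter> L = {}")
  case True
  then have "unlabeled lab M"
    using loop_inv_dom[OF L] by (auto simp: unlabeled_def)
  then show ?thesis using none exp by (auto simp: expandable_def)
next
  case False
  then obtain F where F: "F \<in> M" "F \<in> L" by blast
  obtain V where V: "L = \<Union>V" "covered Ks R V lab"
    using L by (auto simp: loop_inv_def)
  have "M \<notin> V" using exp V by (auto simp: expandable_def)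
  then have "\<forall>G\<in>M. G \<in> L \<longrightarrow> F = G"
    using maxset_meets_covered_once[OF V(2) M] F V by blast
  then have "unlabeled lab (M - {F})"
    using loop_inv_dom[OF L] by (auto simp: unlabeled_def)
  moreover obtain l where "lab F = Some l" using F loop_inv_dom[OF L] by blast
  moreover obtain G where "G \<in> M - {F}" using exp F by (auto simp: expandable_def)
  ultimately show ?thesis using one F by blast
qed

section \<open>The maxsets selected by the labeling\<close>

text \<open>A missing maxset \<open>N\<close> would lie inside \<open>\<Union>V\<close> yet meet it
  only once, so it would be a single formula contained in some member of \<open>V\<close>, against
  maximality. A nonempty \<open>Ks\<close> excludes the empty maxset.\<close>

lemma covered_all_maxsets:
  assumes V: "covered Ks R V lab" and "Ks \<subseteq> \<Union>V" and ne: "Ks \<noteq> {}"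
  shows "V = maxsets Ks"
proof
  show "V \<subseteq> maxsets Ks" using V by (simp add: covered_def)
  show "maxsets Ks \<subseteq> V"
  proof (rule ccontr)
    assume "\<not> maxsets Ks \<subseteq> V"
    then obtain N where N: "N \<in> maxsets Ks" "N \<notin> V" by blast
    obtain F where "F \<in> Ks" using ne by blast
    then have "N \<noteq> {}"
      using maxsets_maximal[OF N(1), of "{F}"] consistent_single by auto
    then obtain F where F: "F \<in> N" by blast
    have NL: "N \<subseteq> \<Union>V" using N assms(2) by (auto simp: maxsets_def)
    then obtain E where E: "E \<in> V" "F \<in> E" using F by blast
    have "N \<subseteq> E"
      using maxset_meets_covered_once[OF V N F] NL F E by blast
    then show False
      using maxsets_subset_eq[of N Ks E] N E V by (auto simp: covered_def)
  qed
qed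

text \<open>To beat \<open>M\<close>, a maxset \<open>N\<close> must contain the formula
  \<open>G\<close> that \<open>M\<close> has in class 1, so its other formulae are in a class
  \<open>k \<ge> n\<close>, and only there can it win. But \<open>M\<close> has a formula outside
  \<open>N\<close> in class \<open>n\<close>, which is reached no later.\<close>

lemma not_prio_less_entailing:
  assumes cov: "covered Ks R (maxsets Ks) lab"
    and M: "M \<in> maxsets Ks" "entails M R" and N: "N \<in> maxsets Ks"
  shows "\<not> prio_less (ordering_of lab) N M"
proof
  let ?C = "label_class lab"
  assume less: "prio_less (ordering_of lab) N M"
  have wl: "well_labeled R lab E" if "E \<in> maxsets Ks" for E
    using cov that by (simp add: covered_def)
  have fin: "finite (dom lab)"
    using cov finite_Ks by (auto simp: covered_def maxsets_def intro: finite_subset[of _ Ks])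
  then obtain i where i: "\<And>j. j < i \<Longrightarrow> ?C j \<inter> N = ?C j \<inter> M" "?C i \<inter> N \<supset> ?C i \<inter> M"
    using less unfolding prio_less_ordering_of[OF fin] by blast
  obtain G n where G: "labeled_1n lab M G n n"
    using wl[OF M(1)] M(2) by (auto simp: well_labeled_def)
  have "i \<noteq> 0"
  proof
    assume "i = 0"
    then obtain F l where "F \<in> N" "lab F = Some l" "class_number l = 0"
      using i(2) by (auto simp: label_class_def)
    then show False using well_labeled_class_pos[OF wl[OF N]] by fastforce
  qed
  have G1: "G \<in> ?C 1 \<inter> M" using G by (auto simp: labeled_1n_def label_class_def)
  \<comment> \<open>Class 1 is either the deciding class, with strict inclusion, or an earlier one,
    with equality.\<close>
  moreover have "?C 1 \<inter> M \<subseteq> N"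
  proof (cases "i = 1")
    case True
    then show ?thesis using i(2) by blast
  next
    case False
    then show ?thesis using i(1)[of 1] \<open>i \<noteq> 0\<close> by auto
  qed
  ultimately have "G \<in> N" by blast
  have lG: "lab G = Some (OneAnd n)" "n \<ge> 2" "G \<in> M" using G by (auto simp: labeled_1n_def)
  \<comment> \<open>The label of \<open>G\<close> carries the number \<open>n\<close>, so
    \<open>N\<close> has its other formulae in class \<open>n\<close> or \<open>n + 1\<close>,
    according to whether it entails \<open>R\<close>.\<close>
  obtain k where "k \<ge> n" and Nk: "labeled_1n lab N G n k"
  proof (cases "entails N R")
    case True
    then obtain G' n' where "labeled_1n lab N G' n' n'"
      using wl[OF N] by (auto simp: well_labeled_def)
    with labeled_1n_unique[OF this \<open>G \<in> N\<close> lG(1)] show ?thesis using that[of n'] by simp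
  next
    case False
    then obtain G' n' where "labeled_1n lab N G' n' (n' + 1)"
      using wl[OF N] lG \<open>G \<in> N\<close> by (fastforce simp: well_labeled_def)
    with labeled_1n_unique[OF this \<open>G \<in> N\<close> lG(1)] show ?thesis using that[of "n' + 1"] by simp
  qed
  obtain F where F: "F \<in> ?C i" "F \<in> N" "F \<notin> M" using i(2) by blast
  then have "M \<noteq> N" and "F \<noteq> G" using lG by auto
  then have "i = k" using F Nk by (auto simp: labeled_1n_def label_class_def)
  have meet: "H = G" if "H \<in> M" "H \<in> N" for H
    using maxsets_meet_once[OF M(1) N \<open>M \<noteq> N\<close>] that lG \<open>G \<in> N\<close> by blast
  obtain H where H: "H \<in> M" "H \<notin> N"
    using maxsets_subset_eq[OF M(1) N] \<open>M \<noteq> N\<close> by blast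
  then have "H \<in> ?C n" using G \<open>G \<in> N\<close> by (auto simp: labeled_1n_def label_class_def)
  then show False using i(1)[of n] i(2) H \<open>i = k\<close> \<open>k \<ge> n\<close> by (cases "i = n") auto
qed

text \<open>If \<open>M\<close> has nothing in class 1, then \<open>S\<close> wins there. Otherwise
  \<open>M\<close> shares its formula \<open>G\<close> of class 1 with a maxset \<open>N\<close>
  that entails \<open>R\<close>; the two first differ in class \<open>n\<close>, where
  \<open>N\<close> has a formula and \<open>M\<close> has none.\<close>

lemma prio_less_not_entailing:
  assumes cov: "covered Ks R (maxsets Ks) lab"
    and M: "M \<in> maxsets Ks" "\<not> entails M R" and S: "S \<in> maxsets Ks" "entails S R"
  shows "\<exists>N\<in>maxsets Ks. prio_less (ordering_of lab) N M"
proof -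
  let ?C = "label_class lab"
  have wl: "well_labeled R lab E" if "E \<in> maxsets Ks" for E
    using cov that by (simp add: covered_def)
  have fin: "finite (dom lab)"
    using cov finite_Ks by (auto simp: covered_def maxsets_def intro: finite_subset[of _ Ks])
  have C0: "?C 0 \<inter> N = {}" if "N \<in> maxsets Ks" for N
    using well_labeled_class_pos[OF wl[OF that]] by (fastforce simp: label_class_def)
  consider "\<forall>F\<in>M. \<exists>n\<ge>2. lab F = Some (Only n)" | G n where "labeled_1n lab M G n (n + 1)"
    using wl[OF M(1)] M(2) by (auto simp: well_labeled_def)
  then show ?thesis
  proof cases
    case 1
    then have "?C 1 \<inter> M = {}" by (fastforce simp: label_class_def)
    moreover obtain G n where "labeled_1n lab S G n n"
      using wl[OF S(1)] S(2) by (auto simp: well_labeled_def)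
    then have "G \<in> ?C 1 \<inter> S" by (auto simp: labeled_1n_def label_class_def)
    ultimately have "prio_less (ordering_of lab) S M"
      unfolding prio_less_ordering_of[OF fin] using C0 M(1) S(1)
      by (intro exI[of _ 1]) auto
    then show ?thesis using S by blast
  next
    case 2
    then have G: "G \<in> M" "lab G = Some (OneAnd n)" "n \<ge> 2" by (auto simp: labeled_1n_def)
    then obtain N where N: "N \<in> maxsets Ks" "G \<in> N" "entails N R"
      using cov unfolding covered_def by blast
    obtain G' n' where G': "labeled_1n lab N G' n' n'"
      using wl[OF N(1)] N(3) by (auto simp: well_labeled_def)
    with labeled_1n_unique[OF this N(2) G(2)] have Nn: "labeled_1n lab N G n n" by simp
    have "N \<noteq> M" using N M by blast
    then obtain F where F: "F \<in> N" "F \<notin> M"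
      using maxsets_subset_eq[OF N(1) M(1)] by blast
    have "?C j \<inter> N = ?C j \<inter> M" if "j < n" for j
      using that by (simp add: label_class_labeled_1n[OF 2] label_class_labeled_1n[OF Nn])
    \<comment> \<open>\<open>n \<ge> 2\<close> keeps class \<open>n\<close> apart from the class 1
      of \<open>G\<close>, and the other formulae of \<open>M\<close> are in class
      \<open>n + 1\<close>.\<close>
    moreover have "?C n \<inter> M = {}"
      using G(3) by (simp add: label_class_labeled_1n[OF 2])
    moreover have "F \<in> ?C n \<inter> N"
      using F G Nn by (auto simp: labeled_1n_def label_class_def)
    ultimately have "prio_less (ordering_of lab) N M"
      unfolding prio_less_ordering_of[OF fin]
      by (intro exI[of _ n]) auto
    then show ?thesis using N by blast
  qed
qed

lemma final_correct:
  assumes L: "loop_inv Ks R L lab" "Ks \<subseteq> L"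
  shows "priority_ordering Ks (ordering_of lab)"
    and "generates Ks (ordering_of lab) R \<longleftrightarrow> obtainable Ks R"
proof -
  obtain V where V: "L = \<Union>V" "covered Ks R V lab"
    using L by (auto simp: loop_inv_def)
  have "dom lab = Ks" using V L by (auto simp: covered_def maxsets_def)
  then show prio: "priority_ordering Ks (ordering_of lab)"
    using priority_ordering_ordering_of[of lab] finite_Ks by simp
  have "generates Ks (ordering_of lab) R" if gen: "priority_ordering Ks P" "generates Ks P R" for P
  proof (cases "Ks = {}")
    case True
    \<comment> \<open>An empty \<open>Ks\<close> leaves a single priority ordering. It is treated
      apart because the empty maxset may be missing from \<open>V\<close>.\<close>
    have "P = []" if "priority_ordering {} P" for P :: "'a form set list"
      using that by (auto simp: priority_ordering_def partition_on_empty)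
    then have "P = ordering_of lab" using gen prio True by metis
    then show ?thesis using gen by simp
  next
    case False
    then have cov: "covered Ks R (maxsets Ks) lab"
      using covered_all_maxsets V L by blast
    have sel: "selected Ks P = {M \<in> maxsets Ks. entails M R}"
      using selected_if_generates[OF finite_Ks gen(2)] .
    \<comment> \<open>A model of \<open>R\<close> satisfies some maxset selected by
      \<open>P\<close>; this yields the entailing maxset that defeats those without a formula in
      class 1.\<close>
    obtain v where "sat v R" using consistent_R by (auto simp: consistent_def)
    then obtain S where "S \<in> maxsets Ks" "entails S R"
      using gen(2) sel unfolding generates_iff[OF finite_Ks] by blast
    then have "selected Ks (ordering_of lab) = {M \<in> maxsets Ks. entails M R}"
      using not_prio_less_entailing[OF cov] prio_less_not_entailing[OF cov]
      unfolding selected_def by blast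
    then show ?thesis using gen(2) sel by (simp add: generates_iff[OF finite_Ks])
  qed
  then show "generates Ks (ordering_of lab) R \<longleftrightarrow> obtainable Ks R"
    using prio by (auto simp: obtainable_def)
qed

section \<open>Correctness of the algorithm\<close>

lemma invariant_initial: "invariant Ks R initial_state"
  by (auto simp: initial_state_def loop_inv_def covered_def intro!: exI[of _ "{}"])

text \<open>For the labeling rules, it suffices that old labels survive, the domain grows by
  \<open>M\<close>, and \<open>M\<close> becomes well labeled.\<close>

lemma invariant_step:
  assumes "step Ks R s s'" "invariant Ks R s"
  shows "invariant Ks R s'"
  using assms(1)
proof cases
  case (step3_pair F G L lab)
  then show ?thesis using assms(2) by (auto simp: expandable_def)
next
  case (step3_single L F lab)
  then have "expandable Ks L {F}"
    using consistent_single unfolding expandable_def by blast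
  then show ?thesis using assms(2) step3_single by simp
next
  case (step4_none M T L lab)
  have M: "M \<subseteq> Ks" "consistent M" and T: "\<forall>F\<in>T. F \<in> M \<or> \<not> consistent (insert F M)"
    using assms(2) step4_none by (auto simp: expandable_def)
  \<comment> \<open>A formula \<open>F\<close> that enlarges \<open>M\<close> consistently is
    consistent with each member of \<open>M\<close>; if untried it would still be a candidate, and
    if tried it would have been accepted or found inconsistent.\<close>
  have "N = M" if N: "N \<subseteq> Ks" "consistent N" "M \<subseteq> N" for N
  proof (rule ccontr)
    assume "N \<noteq> M"
    then obtain F where F: "F \<in> N" "F \<notin> M" using N by blast
    have ins: "insert F M \<subseteq> N" using F N by blast
    then have "consistent (insert F M)" using consistent_mono N by blast
    moreover have "\<forall>G\<in>M. consistent {G, F}"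
      using ins by (auto intro!: consistent_mono[OF N(2)])
    ultimately show False using step4_none(3) T F N by blast
  qed
  then have "M \<in> maxsets Ks" using M by (auto simp: maxsets_def)
  then show ?thesis using assms(2) step4_none by simp
next
  case (step6 F M L T lab)
  \<comment> \<open>Inconsistency persists as \<open>M\<close> grows, so rejected formulae need no
    second trial.\<close>
  have "\<not> consistent (insert G (insert F M))" if "\<not> consistent (insert G M)" for G
    using that consistent_mono[of "insert G (insert F M)" "insert G M"] by auto
  then show ?thesis using assms(2) step6 by (auto simp: expandable_def)
next
  case (step8a M lab F L)
  then obtain L0 where L0: "L = L0 \<union> M" "loop_inv Ks R L0 lab" "expandable Ks L0 M"
    "M \<in> maxsets Ks" using assms(2) by auto
  let ?lab = "label_all (lab(F \<mapsto> OneAnd 2)) (M - {F}) (Only 2)"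
  have "well_labeled R ?lab M"
  proof -
    have "labeled_1n ?lab M F 2 2"
      using step8a  by (auto simp: labeled_1n_def label_all_def)
    then show ?thesis using step8a unfolding well_labeled_def by auto
  qed
  moreover have "lab \<subseteq>\<^sub>m ?lab"
    using step8a by (intro map_le_label_all_upd) (auto simp: unlabeled_def)
  moreover have "dom ?lab = L0 \<union> M"
    using step8a loop_inv_dom[OF L0(2)] by (auto simp: dom_label_all)
  ultimately have "loop_inv Ks R (L0 \<union> M) ?lab"
    using step8a by (intro loop_inv_label[OF L0(2-4)]) simp_all
  then show ?thesis using step8a L0 by simp
next
  case (step8b M F lab n L)
  then obtain L0 where L0: "L = L0 \<union> M" "loop_inv Ks R L0 lab" "expandable Ks L0 M"
    "M \<in> maxsets Ks" using assms(2) by auto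
  let ?lab = "label_all lab (M - {F}) (Only n)"
  have "well_labeled R ?lab M"
  proof -
    have "labeled_1n ?lab M F n n"
      using step8b loop_inv_ge2[OF L0(2)] by (auto simp: labeled_1n_def label_all_def)
    then show ?thesis using step8b unfolding well_labeled_def by auto
  qed
  moreover have "lab \<subseteq>\<^sub>m ?lab"
    using step8b by (intro map_le_label_all)
  moreover have "dom ?lab = L0 \<union> M"
    using step8b loop_inv_dom[OF L0(2)] by (auto simp: dom_label_all)
  ultimately have "loop_inv Ks R (L0 \<union> M) ?lab"
    using step8b by (intro loop_inv_label[OF L0(2-4)]) simp_all
  then show ?thesis using step8b L0 by simp
next
  case (step8c M F lab n G L)
  then obtain L0 where L0: "L = L0 \<union> M" "loop_inv Ks R L0 lab" "expandable Ks L0 M"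
    "M \<in> maxsets Ks" using assms(2) by auto
  let ?lab = "label_all (lab(G \<mapsto> OneAnd n)) (M - {F, G}) (Only n)"
  have "well_labeled R ?lab M"
  proof -
    have "labeled_1n ?lab M G n n"
      using step8c loop_inv_ge2[OF L0(2)] by (auto simp: labeled_1n_def label_all_def)
    then show ?thesis using step8c unfolding well_labeled_def by auto
  qed
  moreover have "lab \<subseteq>\<^sub>m ?lab"
    using step8c by (intro map_le_label_all_upd) (auto simp: unlabeled_def)
  moreover have "dom ?lab = L0 \<union> M"
    using step8c loop_inv_dom[OF L0(2)] by (auto simp: dom_label_all)
  ultimately have "loop_inv Ks R (L0 \<union> M) ?lab"
    using step8c by (intro loop_inv_label[OF L0(2-4)]) simp_all
  then show ?thesis using step8c L0 by simp
next
  case (step9a M lab L)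
  then obtain L0 where L0: "L = L0 \<union> M" "loop_inv Ks R L0 lab" "expandable Ks L0 M"
    "M \<in> maxsets Ks" using assms(2) by auto
  let ?lab = "label_all lab M (Only 2)"
  have "well_labeled R ?lab M"
    using step9a by (auto simp: well_labeled_def label_all_def)
  moreover have "lab \<subseteq>\<^sub>m ?lab"
    using step9a by (intro map_le_label_all)
  moreover have "dom ?lab = L0 \<union> M"
    using step9a loop_inv_dom[OF L0(2)] by (auto simp: dom_label_all)
  ultimately have "loop_inv Ks R (L0 \<union> M) ?lab"
    \<comment> \<open>All new labels are of the form \<open>Only\<close>, so no new witness
      entailing \<open>R\<close> is called for.\<close>
    using step9a by (intro loop_inv_label[OF L0(2-4)]) (auto simp: label_all_def split: if_splits)
  then show ?thesis using step9a L0 by simp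
next
  case (step9b M F lab n L)
  then obtain L0 where L0: "L = L0 \<union> M" "loop_inv Ks R L0 lab" "expandable Ks L0 M"
    "M \<in> maxsets Ks" using assms(2) by auto
  let ?lab = "label_all lab (M - {F}) (Only (n + 1))"
  have "well_labeled R ?lab M"
  proof -
    have "labeled_1n ?lab M F n (n + 1)"
      using step9b loop_inv_ge2[OF L0(2)] by (auto simp: labeled_1n_def label_all_def)
    then show ?thesis using step9b unfolding well_labeled_def by auto
  qed
  moreover have "lab \<subseteq>\<^sub>m ?lab"
    using step9b by (intro map_le_label_all)
  moreover have "dom ?lab = L0 \<union> M"
    using step9b loop_inv_dom[OF L0(2)] by (auto simp: dom_label_all)
  ultimately have "loop_inv Ks R (L0 \<union> M) ?lab"
    using step9b by (intro loop_inv_label[OF L0(2-4)]) (auto simp: label_all_def split: if_splits)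
  then show ?thesis using step9b L0 by simp
next
  case (step9c M F lab n L)
  then obtain L0 where L0: "L = L0 \<union> M" "loop_inv Ks R L0 lab" "expandable Ks L0 M"
    "M \<in> maxsets Ks" using assms(2) by auto
  let ?lab = "label_all lab (M - {F}) (Only n)"
  have "well_labeled R ?lab M"
    using step9c loop_inv_ge2[OF L0(2)] by (auto simp: well_labeled_def label_all_def)
  moreover have "lab \<subseteq>\<^sub>m ?lab"
    using step9c by (intro map_le_label_all)
  moreover have "dom ?lab = L0 \<union> M"
    using step9c loop_inv_dom[OF L0(2)] by (auto simp: dom_label_all)
  ultimately have "loop_inv Ks R (L0 \<union> M) ?lab"
    using step9c by (intro loop_inv_label[OF L0(2-4)]) (auto simp: label_all_def split: if_splits)
  then show ?thesis using step9c L0 by simp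
next
  case (step8d_9d lab M L)
  then obtain L0 where "loop_inv Ks R L0 lab" "expandable Ks L0 M" "M \<in> maxsets Ks"
    using assms(2) by auto
  then show ?thesis
    by (cases rule: new_maxset_cases) (use step8d_9d in auto)
next
  case (final_yes lab)
  then show ?thesis using assms(2) final_correct by auto
next
  case (final_no lab)
  then show ?thesis using assms(2) final_correct by auto
qed (use assms(2) in auto)

lemma reachable_invariant:
  assumes "reachable Ks R s"
  shows "invariant Ks R s"
  using assms unfolding reachable_def
  by (induction rule: rtranclp_induct) (auto intro: invariant_initial invariant_step)

text \<open>Every other state has a successor, except \<open>Error\<close>, which the invariant
  excludes. Only step 8 needs more than its rules: there the overlap of \<open>M\<close> with the
  labeled formulae supplies an applicable case.\<close>

lemma halted_declared:
  assumes inv: "invariant Ks R s" and halt: "halted Ks R s"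
  shows "s = Declared_Not_Obtainable \<or> (\<exists>P. s = Declared_Obtainable P)"
proof -
  have stuck: "\<not> step Ks R s s'" for s' using halt by (auto simp: halted_def)
  show ?thesis
  proof (cases s)
    case (Step3 L lab)
    then show ?thesis using stuck
      by (metis step.step3_pair step.step3_single step.step3_stop subsetI)
  next
    case (Step4 L M T lab)
    then show ?thesis using stuck by (metis step.step4_choose step.step4_none)
  next
    case (Step5 L M T F lab)
    then show ?thesis using stuck by (metis step.step5 step.step6)
  next
    case (Step7 L M lab)
    then show ?thesis using stuck by (metis step.step7)
  next
    case (Step8 L M lab)
    then obtain L0 where "loop_inv Ks R L0 lab" "expandable Ks L0 M" "M \<in> maxsets Ks"
      using inv by auto
    then show ?thesis
    proof (cases rule: new_maxset_cases)
      case none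
      then show ?thesis using stuck Step8 by (metis step.step8a step.step9a all_not_in_conv)
    next
      case (one F l G)
      \<comment> \<open>Entailment of \<open>R\<close> decides between steps 8 and 9, the form of
        \<open>l\<close> between their cases (b) and (c).\<close>
      then show ?thesis using stuck Step8
        by (cases l) (metis step.step8b step.step9b, metis step.step8c step.step9c)
    qed
  next
    case (Final lab)
    then show ?thesis using stuck by (metis step.final_yes step.final_no)
  qed (use inv in auto)
qed

end

theorem theorem7:
  fixes K :: "nat \<Rightarrow> 'a form" and m :: nat and R :: "'a form"
  defines "Ks \<equiv> K ` {1..m}"
  assumes "\<And>i. i \<in> {1..m} \<Longrightarrow> consistent {K i}"
    and "consistent {R}"
    and "berge_acyclic (maxsets Ks)"
  shows "always_terminates Ks R \<and>
    (\<forall>s. reachable Ks R s \<and> halted Ks R s \<longrightarrow>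
       (if obtainable Ks R
        then \<exists>P. s = Declared_Obtainable P \<and> priority_ordering Ks P \<and> generates Ks P R
        else s = Declared_Not_Obtainable))"
proof -
  interpret acyclic_merging Ks R
    using assms by unfold_locales auto
  have "if obtainable Ks R
        then \<exists>P. s = Declared_Obtainable P \<and> priority_ordering Ks P \<and> generates Ks P R
        else s = Declared_Not_Obtainable"
    if "reachable Ks R s" "halted Ks R s" for s
    using halted_declared[OF reachable_invariant] reachable_invariant that by fastforce
  then show ?thesis using always_terminates_if_finite[OF finite_Ks] by blast
qed

end
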